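(* Let $k_{\rm S},k_{\rm T}\ge 1$ be integers, let $z_1,\dots,z_n\in\mathbb R^{k_{\rm S}}$ be fixed response vectors with labels $y_1,\dots,y_n\in\{1,\dots,k_{\rm T}\}$ such that every class $c\in\{1,\dots,k_{\rm T}\}$ occurs at least once and $n>k_{\rm T}$, and let $\rho\in[0,1]$ be a fixed shrinkage coefficient. Assume that the regularized covariance of the joint (batch) fit defined in the context is invertible. Then the affine mapping $z\mapsto\omega^\top z+b$ that Bayesian Discriminant Mapping (BDM) computes from the streaming statistics $(\mathbf n,S,Q)$ is well defined and is exactly the same as the affine mapping obtained by fitting BDM jointly to all training responses; that is, $$(\omega^{\rm stream},b^{\rm stream})=(\omega^{\rm batch},b^{\rm batch}).$$
   Context: **BDM solve.** Fix once and for all a deterministic rule $d$ assigning to each symmetric matrix $A\in\mathbb R^{k_{\rm S}\times k_{\rm S}}$ and each $\rho\in[0,1]$ a diagonal shift $d(A,\rho)\ge 0$ (for example a constant; in practice it is positive only when needed for a stable factorization). The same rule is used in both fits below. Given vectors $\mu_1,\dots,\mu_{k_{\rm T}}\in\mathbb R^{k_{\rm S}}$ (class means), numbers $\pi_1,\dots,\pi_{k_{\rm T}}>0$ (class priors), a symmetric matrix $A\in\mathbb R^{k_{\rm S}\times k_{\rm S}}$ (shared covariance) and $\rho\in[0,1]$, define the regularized covariance $$A_\rho=(1-\rho)A+\rho\,\frac{\operatorname{tr}(A)}{k_{\rm S}}I+d(A,\rho)\,I .$$ If $A_\rho$ is invertible, the BDM parameters are $\omega\in\mathbb R^{k_{\rm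 S}\times k_{\rm T}}$ and $b\in\mathbb R^{k_{\rm T}}$ determined by $$A_\rho\,\omega=[\mu_1,\dots,\mu_{k_{\rm T}}],\qquad b_c=-\tfrac12\,\mu_c^\top\omega_{:,c}+\log\pi_c\quad(c=1,\dots,k_{\rm T}),$$ where $\omega_{:,c}$ is the $c$-th column of $\omega$. The associated affine label mapping is $z\mapsto\omega^\top z+b$. **Joint (batch) fit.** With $n_c=|\{i:y_i=c\}|$, the parameters $(\omega^{\rm batch},b^{\rm batch})$ are the BDM parameters for $$\mu_c=\frac1{n_c}\sum_{i:\,y_i=c}z_i,\qquad \pi_c=\frac{n_c}{n},\qquad A=\frac{1}{n-k_{\rm T}}\sum_{c=1}^{k_{\rm T}}\ \sum_{i:\,y_i=c}(z_i-\mu_c)(z_i-\mu_c)^\top ,$$ i.e. the empirical class means, the empirical class priors and the pooled within-class covariance. **Streaming fit.** The streaming statistics, which can be accumulated in a single traversal of the data, are $$\mathbf n=(n_1,\dots,n_{k_{\rm T}}),\quad n_c=\sum_{i=1}^n\mathbf 1[y_i=c],\qquad S=[s_1,\dots,s_{k_{\rm T}}],\quad s_c=\sum_{i:\,y_i=c}z_i,\qquad Q=\sum_{i=1}^n z_iz_i^\top .$$ The parameters $(\omega^{\rm stream},b^{\rm stream})$ are the BDM parameters for $$\mu_c=\frac{s_c}{n_c},\qquad \pi_c=\frac{n_c}{n},\qquad A=\frac{Q-\sum_{c=1}^{k_{\rm T}}s_cs_c^\top/n_c}{n-k_{\rm T}},\qquad n=\sum_{c}n_c .$$ *)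

theory Defs
  imports "HOL-Analysis.Analysis"
begin

text \<open>A \<open>k\<^sub>S \<times> k\<^sub>T\<close> matrix has type \<open>real^'t^'s\<close> (first index: row), where
  \<open>k\<^sub>S = CARD('s)\<close> and \<open>k\<^sub>T = CARD('t)\<close>; class labels are the elements of \<open>'t\<close>.\<close>

definition outer :: "real^'s \<Rightarrow> real^'s \<Rightarrow> real^'s^'s" where
  "outer u v = (\<chi> i j. u $ i * v $ j)"

definition of_columns :: "('t \<Rightarrow> real^'s) \<Rightarrow> real^'t^'s" where
  "of_columns \<mu> = (\<chi> i c. \<mu> c $ i)"

text \<open>The rule \<open>d\<close> is a total function, but only its values at symmetric matrices and
  at \<open>\<rho> \<in> [0,1]\<close> are meaningful.\<close>

definition regularized_cov ::
  "(real^'s^'s \<Rightarrow> real \<Rightarrow> real) \<Rightarrow> real^'s^'s \<Rightarrow> real \<Rightarrow> real^'s^'s" where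
  "regularized_cov d A \<rho> =
     (1 - \<rho>) *\<^sub>R A + (\<rho> * (trace A / real CARD('s))) *\<^sub>R mat 1 + d A \<rho> *\<^sub>R mat 1"

definition bdm_admissible ::
  "(real^'s^'s \<Rightarrow> real \<Rightarrow> real) \<Rightarrow> ('t \<Rightarrow> real) \<Rightarrow> real^'s^'s \<Rightarrow> real \<Rightarrow> bool" where
  "bdm_admissible d p A \<rho> \<longleftrightarrow>
     (\<forall>c. p c > 0) \<and> transpose A = A \<and> \<rho> \<in> {0..1} \<and> invertible (regularized_cov d A \<rho>)"

definition is_bdm_params ::
  "(real^'s^'s \<Rightarrow> real \<Rightarrow> real) \<Rightarrow> ('t \<Rightarrow> real^'s) \<Rightarrow> ('t \<Rightarrow> real) \<Rightarrow> real^'s^'s \<Rightarrow> real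
     \<Rightarrow> (real^'t^'s) \<times> (real^'t) \<Rightarrow> bool" where
  "is_bdm_params d \<mu> p A \<rho> = (\<lambda>(\<omega>, b).
     regularized_cov d A \<rho> ** \<omega> = of_columns \<mu> \<and>
     (\<forall>c. b $ c = - (1/2) * (\<mu> c \<bullet> column c \<omega>) + ln (p c)))"

text \<open>Meaningful only when the regularized covariance is invertible.\<close>

definition bdm_params ::
  "(real^'s^'s \<Rightarrow> real \<Rightarrow> real) \<Rightarrow> ('t \<Rightarrow> real^'s) \<Rightarrow> ('t \<Rightarrow> real) \<Rightarrow> real^'s^'s \<Rightarrow> real
     \<Rightarrow> (real^'t^'s) \<times> (real^'t)" where
  "bdm_params d \<mu> p A \<rho> = (THE \<theta>. is_bdm_params d \<mu> p A \<rho> \<theta>)"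

definition affine_label_map :: "(real^'t^'s) \<times> (real^'t) \<Rightarrow> real^'s \<Rightarrow> real^'t" where
  "affine_label_map = (\<lambda>(\<omega>, b) z. transpose \<omega> *v z + b)"

text \<open>The data are \<open>z\<^sub>1, \<dots>, z\<^sub>n\<close> and \<open>y\<^sub>1, \<dots>, y\<^sub>n\<close>;
  values of \<open>z\<close> and \<open>y\<close> outside \<open>{1..n}\<close> are ignored.\<close>

definition class_indices :: "nat \<Rightarrow> (nat \<Rightarrow> 't) \<Rightarrow> 't \<Rightarrow> nat set" where
  "class_indices n y c = {i \<in> {1..n}. y i = c}"

definition batch_mean :: "nat \<Rightarrow> (nat \<Rightarrow> real^'s) \<Rightarrow> (nat \<Rightarrow> 't) \<Rightarrow> 't \<Rightarrow> real^'s" where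
  "batch_mean n z y c =
     (1 / real (card (class_indices n y c))) *\<^sub>R (\<Sum>i\<in>class_indices n y c. z i)"

definition batch_prior :: "nat \<Rightarrow> (nat \<Rightarrow> 't) \<Rightarrow> 't \<Rightarrow> real" where
  "batch_prior n y c = real (card (class_indices n y c)) / real n"

definition batch_cov ::
  "nat \<Rightarrow> (nat \<Rightarrow> real^'s) \<Rightarrow> (nat \<Rightarrow> 't::finite) \<Rightarrow> real^'s^'s" where
  "batch_cov n z y =
     (1 / (real n - real CARD('t))) *\<^sub>R
       (\<Sum>c\<in>UNIV. \<Sum>i\<in>class_indices n y c.
          outer (z i - batch_mean n z y c) (z i - batch_mean n z y c))"

definition batch_params ::
  "(real^'s^'s \<Rightarrow> real \<Rightarrow> real) \<Rightarrow> nat \<Rightarrow> (nat \<Rightarrow> real^'s) \<Rightarrow> (nat \<Rightarrow> 't::finite) \<Rightarrow> real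
     \<Rightarrow> (real^'t^'s) \<times> (real^'t)" where
  "batch_params d n z y \<rho> =
     bdm_params d (batch_mean n z y) (batch_prior n y) (batch_cov n z y) \<rho>"

definition stat_count :: "nat \<Rightarrow> (nat \<Rightarrow> 't) \<Rightarrow> 't \<Rightarrow> nat" where
  "stat_count n y c = (\<Sum>i=1..n. of_bool (y i = c))"

definition stat_sum :: "nat \<Rightarrow> (nat \<Rightarrow> real^'s) \<Rightarrow> (nat \<Rightarrow> 't) \<Rightarrow> real^'t^'s" where
  "stat_sum n z y = of_columns (\<lambda>c. \<Sum>i\<in>class_indices n y c. z i)"

definition stat_gram :: "nat \<Rightarrow> (nat \<Rightarrow> real^'s) \<Rightarrow> real^'s^'s" where
  "stat_gram n z = (\<Sum>i=1..n. outer (z i) (z i))"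

text \<open>The streaming fit is a function of the statistics \<open>(N, S, Q)\<close> only; the sample
  size is recovered as \<open>\<Sum>c. N c\<close>.\<close>

definition stream_mean :: "('t \<Rightarrow> nat) \<Rightarrow> real^'t^'s \<Rightarrow> 't \<Rightarrow> real^'s" where
  "stream_mean N S c = (1 / real (N c)) *\<^sub>R column c S"

definition stream_prior :: "('t::finite \<Rightarrow> nat) \<Rightarrow> 't \<Rightarrow> real" where
  "stream_prior N c = real (N c) / real (\<Sum>c'\<in>UNIV. N c')"

definition stream_cov ::
  "('t::finite \<Rightarrow> nat) \<Rightarrow> real^'t^'s \<Rightarrow> real^'s^'s \<Rightarrow> real^'s^'s" where
  "stream_cov N S Q =
     (1 / (real (\<Sum>c\<in>UNIV. N c) - real CARD('t))) *\<^sub>R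
       (Q - (\<Sum>c\<in>UNIV. (1 / real (N c)) *\<^sub>R outer (column c S) (column c S)))"

definition stream_params ::
  "(real^'s^'s \<Rightarrow> real \<Rightarrow> real) \<Rightarrow> ('t::finite \<Rightarrow> nat) \<Rightarrow> real^'t^'s \<Rightarrow> real^'s^'s \<Rightarrow> real
     \<Rightarrow> (real^'t^'s) \<times> (real^'t)" where
  "stream_params d N S Q \<rho> =
     bdm_params d (stream_mean N S) (stream_prior N) (stream_cov N S Q) \<rho>"

text \<open>The first two conjuncts say that no denominator in the streaming fit vanishes,
  the third that its BDM inputs are legitimate, and the last that the defining equations
  have exactly one solution.\<close>

definition stream_well_defined ::
  "(real^'s^'s \<Rightarrow> real \<Rightarrow> real) \<Rightarrow> ('t::finite \<Rightarrow> nat) \<Rightarrow> real^'t^'s \<Rightarrow> real^'s^'s \<Rightarrow> real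
     \<Rightarrow> bool" where
  "stream_well_defined d N S Q \<rho> \<longleftrightarrow>
     (\<forall>c. N c > 0) \<and>
     (\<Sum>c\<in>UNIV. N c) > CARD('t) \<and>
     bdm_admissible d (stream_prior N) (stream_cov N S Q) \<rho> \<and>
     (\<exists>!\<theta>. is_bdm_params d (stream_mean N S) (stream_prior N) (stream_cov N S Q) \<rho> \<theta>)"

end

theory Submission
  imports Defs
begin

text \<open>Both fits feed the same inputs into the BDM equations. For each class \<open>c\<close> the
  within-class scatter is
  \<open>\<Sum>(z\<^sub>i - \<mu>\<^sub>c)(z\<^sub>i - \<mu>\<^sub>c)\<^sup>T = \<Sum>z\<^sub>iz\<^sub>i\<^sup>T - s\<^sub>cs\<^sub>c\<^sup>T/n\<^sub>c\<close>, and summing over the classes,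
  which partition the sample, turns the first term into \<open>Q\<close>. Invertibility of the
  regularized covariance makes the solution of the BDM equations unique.\<close>

lemma column_of_columns [simp]: "column c (of_columns \<mu>) = \<mu> c"
  by (simp add: column_def of_columns_def vec_eq_iff)

lemma transpose_outer: "transpose (outer u v) = outer v u"
  by (simp add: outer_def transpose_def vec_eq_iff mult.commute)

lemma transpose_sum: "transpose (\<Sum>i\<in>I. f i) = (\<Sum>i\<in>I. transpose (f i))"
  for f :: "'i \<Rightarrow> real^'m^'n"
  by (simp add: transpose_def vec_eq_iff)

text \<open>Entrywise expansion, with \<open>s\<close> the sum of the \<open>z i\<close> and
  \<open>k = card I\<close>: since \<open>m = s / k\<close>, both cross terms and the constant term
  are products of entries of \<open>s\<close> divided by \<open>k\<close>, with signs -, -, +, so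
  one is subtracted in total.\<close>

lemma sum_outer_centered:
  fixes z :: "'i \<Rightarrow> real^'s"
  assumes "finite I" "m = (1 / real (card I)) *\<^sub>R (\<Sum>i\<in>I. z i)"
  shows "(\<Sum>i\<in>I. outer (z i - m) (z i - m)) =
    (\<Sum>i\<in>I. outer (z i) (z i)) -
    (1 / real (card I)) *\<^sub>R outer (\<Sum>i\<in>I. z i) (\<Sum>i\<in>I. z i)"
\<comment> \<open>For empty \<open>I\<close> all sums vanish; otherwise \<open>card I\<close> is
  nonzero and can be cancelled.\<close>
proof (cases "I = {}")
  case True
  then show ?thesis by (simp add: outer_def vec_eq_iff)
next
  case False
  with assms(1) have k: "real (card I) \<noteq> 0" by simp
  have "(\<Sum>i\<in>I. (z i $ a - m $ a) * (z i $ b - m $ b)) =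
      (\<Sum>i\<in>I. z i $ a * z i $ b) - (\<Sum>i\<in>I. z i $ a) * (\<Sum>i\<in>I. z i $ b) / real (card I)" for a b
  proof -
    have "(\<Sum>i\<in>I. (z i $ a - m $ a) * (z i $ b - m $ b)) =
        (\<Sum>i\<in>I. z i $ a * z i $ b) - (\<Sum>i\<in>I. z i $ a) * m $ b
        - m $ a * (\<Sum>i\<in>I. z i $ b) + real (card I) * (m $ a * m $ b)"
      by (simp add: algebra_simps sum.distrib sum_subtractf sum_distrib_left sum_distrib_right)
    also have "\<dots> = (\<Sum>i\<in>I. z i $ a * z i $ b)
        - (\<Sum>i\<in>I. z i $ a) * (\<Sum>i\<in>I. z i $ b) / real (card I)"
      using k by (simp add: assms(2) field_simps)
    finally show ?thesis .
  qed
  then show ?thesis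
    by (simp add: outer_def vec_eq_iff)
qed

lemma finite_class_indices [simp]: "finite (class_indices n y c)"
  by (simp add: class_indices_def)

text \<open>The class index sets are the fibres of \<open>y\<close> on \<open>{1..n}\<close>, so
  they partition the sample.\<close>

lemma sum_class_indices:
  fixes y :: "nat \<Rightarrow> 't::finite"
  shows "(\<Sum>c\<in>UNIV. \<Sum>i\<in>class_indices n y c. f i) = (\<Sum>i=1..n. f i)"
  unfolding class_indices_def by (rule sum.group) auto

lemma stat_count_eq_card: "stat_count n y c = card (class_indices n y c)"
  by (simp add: stat_count_def class_indices_def Int_def)

lemma sum_stat_count: "(\<Sum>c\<in>UNIV. stat_count n y c) = n"
  for y :: "nat \<Rightarrow> 't::finite"
  using sum_class_indices[of "\<lambda>_. 1::nat" n y] by (simp add: stat_count_eq_card)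

lemma stream_mean_eq_batch_mean:
  "stream_mean (stat_count n y) (stat_sum n z y) = batch_mean n z y"
  by (simp add: fun_eq_iff stream_mean_def batch_mean_def stat_sum_def stat_count_eq_card)

lemma stream_prior_eq_batch_prior: "stream_prior (stat_count n y) = batch_prior n y"
  \<comment> \<open>The total must become \<open>n\<close> first: moving \<open>real\<close> inside
    the sum, or rewriting the counts to cardinalities, would hide the left-hand side of
    \<open>sum_stat_count\<close>.\<close>
  by (simp add: fun_eq_iff stream_prior_def batch_prior_def sum_stat_count del: of_nat_sum)
    (simp add: stat_count_eq_card)

lemma stream_cov_eq_batch_cov:
  "stream_cov (stat_count n y) (stat_sum n z y) (stat_gram n z) = batch_cov n z y"
proof -
  have "(\<Sum>c\<in>UNIV. \<Sum>i\<in>class_indices n y c.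
          outer (z i - batch_mean n z y c) (z i - batch_mean n z y c)) =
      stat_gram n z - (\<Sum>c\<in>UNIV. (1 / real (stat_count n y c)) *\<^sub>R
        outer (column c (stat_sum n z y)) (column c (stat_sum n z y)))"
    by (simp add: sum_outer_centered[OF finite_class_indices batch_mean_def] sum_subtractf
        sum_class_indices stat_gram_def stat_sum_def stat_count_eq_card)
  then show ?thesis
    by (simp add: stream_cov_def batch_cov_def sum_stat_count del: of_nat_sum)
qed

lemma transpose_batch_cov: "transpose (batch_cov n z y) = batch_cov n z y"
  by (simp add: batch_cov_def transpose_scalar transpose_sum transpose_outer)

text \<open>Multiplying by the inverse determines \<open>\<omega>\<close>, and \<open>b\<close> is
  then explicit in \<open>\<omega>\<close>. This makes the \<open>THE\<close> in
  \<open>bdm_params\<close> meaningful.\<close>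

lemma ex1_bdm_params:
  assumes "invertible (regularized_cov d A \<rho>)"
  shows "\<exists>!\<theta>. is_bdm_params d \<mu> p A \<rho> \<theta>"
proof -
  let ?R = "regularized_cov d A \<rho>"
  let ?w = "matrix_inv ?R ** of_columns \<mu>"
  \<comment> \<open>\<open>matrix_inv\<close> is a \<open>SOME\<close> choice; invertibility
    supplies a witness.\<close>
  have "?R ** matrix_inv ?R = mat 1 \<and> matrix_inv ?R ** ?R = mat 1"
    using assms unfolding invertible_def matrix_inv_def by (rule someI_ex)
  then have "?R ** w = of_columns \<mu> \<longleftrightarrow> w = ?w" for w
    by (metis matrix_mul_assoc matrix_mul_lid)
  then have "is_bdm_params d \<mu> p A \<rho> \<theta> \<longleftrightarrow>
      \<theta> = (?w, \<chi> c. - (1/2) * (\<mu> c \<bullet> column c ?w) + ln (p c))" for \<theta>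
    by (auto simp: is_bdm_params_def vec_eq_iff[where x = "snd \<theta>"] prod_eq_iff
        split: prod.splits)
  then show ?thesis by simp
qed

theorem proposition1:
  fixes d :: "real^'s^'s \<Rightarrow> real \<Rightarrow> real"
    and n :: nat
    and z :: "nat \<Rightarrow> real^'s"
    and y :: "nat \<Rightarrow> 't::finite"
    and \<rho> :: real
  assumes shift_nonneg: "\<And>A r. transpose A = A \<Longrightarrow> r \<in> {0..1} \<Longrightarrow> d A r \<ge> 0"
    and every_class: "\<And>c. \<exists>i\<in>{1..n}. y i = c"
    and size: "n > CARD('t)"
    and shrinkage: "\<rho> \<in> {0..1}"
    and batch_invertible: "invertible (regularized_cov d (batch_cov n z y) \<rho>)"
  shows "stream_well_defined d (stat_count n y) (stat_sum n z y) (stat_gram n z) \<rho> \<and>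
    stream_params d (stat_count n y) (stat_sum n z y) (stat_gram n z) \<rho>
      = batch_params d n z y \<rho> \<and>
    affine_label_map (stream_params d (stat_count n y) (stat_sum n z y) (stat_gram n z) \<rho>)
      = affine_label_map (batch_params d n z y \<rho>)"
proof -
  have pos: "stat_count n y c > 0" for c
    using every_class[of c] by (auto simp: stat_count_eq_card card_gt_0_iff class_indices_def)
  then have "batch_prior n y c > 0" for c
    using size by (simp add: batch_prior_def flip: stat_count_eq_card)
  \<comment> \<open>Rewriting the streaming inputs to the batch ones lets the invertibility assumed
    for the batch fit apply.\<close>
  then have "stream_well_defined d (stat_count n y) (stat_sum n z y) (stat_gram n z) \<rho>"
    using pos size shrinkage batch_invertible ex1_bdm_params[OF batch_invertible]
    by (simp add: stream_well_defined_def bdm_admissible_def sum_stat_count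
        stream_mean_eq_batch_mean stream_prior_eq_batch_prior stream_cov_eq_batch_cov
        transpose_batch_cov)
  then show ?thesis
    by (simp add: stream_params_def batch_params_def
        stream_mean_eq_batch_mean stream_prior_eq_batch_prior stream_cov_eq_batch_cov)
qed

end
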